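(* Let $G=(V,E)$ be a connected graph (loops allowed) with a multi-chain ordering $L_0,\dots,L_z$, with vertices in each layer ordered as described in the context, let $H$ be a graph (loops allowed) with vertex set $C$, and let $\mathcal P$ be a list mapping of $G$ (so $\mathcal P(x)\subseteq C$ for each $x\in V$). Assume $H$ has no universal vertex. Then $G$ has a homomorphism to $H$ obeying $\mathcal P$ if and only if the configuration graph contains a directed path from $S_0$ to $S_{z+1}$.
   Context: Graphs are finite without multiple edges, loops allowed. A homomorphism $\chi:G\to H$ is a map $V(G)\to V(H)$ with $\chi(x)\chi(y)\in E(H)$ whenever $xy\in E(G)$; it obeys $\mathcal P$ if $\chi(x)\in\mathcal P(x)$ for all $x$. A vertex $c$ of $H$ is universal if $c$ is adjacent to every vertex of $H$, including itself (has a loop). A chain graph is a bipartite graph with no induced $2K_2$. The multi-chain ordering: $v_0\in V$, $L_i$ is the set of vertices at distance $i$ from $v_0$ ($L_0=\{v_0\}$, $z$ maximal with $L_z\ne\emptyset$), and for each $0\le i<z$ the bipartite graph formed by the edges of $G$ between $L_i$ and $L_{i+1}$ is a chain graph. For $x\in L_i$, $d_-(x)$ is the number of neighbours of $x$ in $L_{i-1}$ ($0$ if $i=0$) and $d_+(x)$ the number of neighbours of $x$ in $L_{i+1}$ ($0$ if $i=z$). The vertices of each layer are ordered by decreasing $d_-$ (ties broken arbitrarily); consequently the neighbours of $x\in L_i$ in $L_{i+1}$ are exactly the first $d_+(x)$ vertices of $L_{i+1}$. A configuration is a pair $(i,B)$ with $1\le i\le z$ and $B:C\to\{0,1,\dots,|L_i|\}$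 such that $B$ takes both the value $0$ and the value $|L_i|$; in addition there are two special configurations $S_0=(0,B_0)$ and $S_{z+1}=(z+1,B_0)$ where $B_0\equiv 0$ on $C$. The configuration graph is the directed graph on all configurations with an edge from $(i,B)$ to $(i',B')$ iff $i'=i+1$ and there is a homomorphism $\chi$ from the subgraph $G_i$ of $G$ induced by $L_i$ to $H$ such that: (1) $\chi(x)\in\mathcal P(x)$ for all $x\in L_i$; (2) for each $c\in C$, $\chi$ does not assign $c$ to any of the first $B(c)$ vertices of $L_i$; (3) for each $x\in L_i$ and each $c\in C$ not adjacent to $\chi(x)$ in $H$, $B'(c)\ge d_+(x)$. *)

theory Defs
  imports "Graph_Theory.Graph_Theory" "HOL-Library.FuncSet"
begin

text \<open>
  An undirected graph with loops allowed and no multiple edges is a \<open>pair_pseudo_graph\<close>: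
  a finite vertex set with a symmetric, not necessarily irreflexive, arc relation. The
  edge \<open>xy\<close> is the pair of arcs \<open>(x, y)\<close> and \<open>(y, x)\<close>, a single arc if \<open>x = y\<close>.
\<close>

definition homomorphism ::
    "('a \<Rightarrow> 'c) \<Rightarrow> ('a, 'b) pre_digraph \<Rightarrow> ('c, 'd) pre_digraph \<Rightarrow> bool" where
  "homomorphism \<chi> G H \<longleftrightarrow>
     (\<forall>x \<in> verts G. \<chi> x \<in> verts H) \<and> (\<forall>x y. x \<rightarrow>\<^bsub>G\<^esub> y \<longrightarrow> \<chi> x \<rightarrow>\<^bsub>H\<^esub> \<chi> y)"

definition obeys :: "('a \<Rightarrow> 'c) \<Rightarrow> ('a \<Rightarrow> 'c set) \<Rightarrow> 'a set \<Rightarrow> bool" where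
  "obeys \<chi> P X \<longleftrightarrow> (\<forall>x \<in> X. \<chi> x \<in> P x)"

definition universal_vertex :: "'c pair_pre_digraph \<Rightarrow> 'c \<Rightarrow> bool" where
  "universal_vertex H c \<longleftrightarrow> c \<in> pverts H \<and> (\<forall>d \<in> pverts H. (c, d) \<in> parcs H)"

definition bipartite :: "'a pair_pre_digraph \<Rightarrow> bool" where
  "bipartite B \<longleftrightarrow> (\<exists>X Y. X \<union> Y = pverts B \<and> X \<inter> Y = {} \<and> parcs B \<subseteq> X \<times> Y \<union> Y \<times> X)"

definition has_induced_2K2 :: "'a pair_pre_digraph \<Rightarrow> bool" where
  "has_induced_2K2 B \<longleftrightarrow>
     (\<exists>a b c d. distinct [a, b, c, d] \<and> {a, b, c, d} \<subseteq> pverts B \<and>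
        arcs (with_proj B \<restriction> {a, b, c, d}) = {(a, b), (b, a), (c, d), (d, c)})"

definition chain_graph :: "'a pair_pre_digraph \<Rightarrow> bool" where
  "chain_graph B \<longleftrightarrow> bipartite B \<and> \<not> has_induced_2K2 B"

text \<open>With all arc weights equal to 1, \<open>\<mu>\<close> is the usual graph distance.\<close>

definition layer :: "'a pair_pre_digraph \<Rightarrow> 'a \<Rightarrow> nat \<Rightarrow> 'a set" where
  "layer G v0 i =
     {v \<in> pverts G. wf_digraph.\<mu> (with_proj G) (\<lambda>_. 1) v0 v = ereal (real i)}"

definition last_layer :: "'a pair_pre_digraph \<Rightarrow> 'a \<Rightarrow> nat" where
  "last_layer G v0 = (GREATEST i. layer G v0 i \<noteq> {})"

definition between_layers :: "'a pair_pre_digraph \<Rightarrow> 'a \<Rightarrow> nat \<Rightarrow> 'a pair_pre_digraph" where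
  "between_layers G v0 i =
     \<lparr> pverts = layer G v0 i \<union> layer G v0 (i + 1),
       parcs = parcs G \<inter> (layer G v0 i \<times> layer G v0 (i + 1) \<union> layer G v0 (i + 1) \<times> layer G v0 i) \<rparr>"

definition multichain_ordering_from :: "'a pair_pre_digraph \<Rightarrow> 'a \<Rightarrow> bool" where
  "multichain_ordering_from G v0 \<longleftrightarrow>
     v0 \<in> pverts G \<and> (\<forall>i < last_layer G v0. chain_graph (between_layers G v0 i))"

text \<open>
  In \<open>d_minus G v0 i x\<close> and \<open>d_plus G v0 i x\<close> the vertex \<open>x\<close> is meant to lie in layer \<open>i\<close>.
  For \<open>i = last_layer G v0\<close> the next layer is empty, so \<open>d_plus\<close> is 0 there.
\<close>

definition d_minus :: "'a pair_pre_digraph \<Rightarrow> 'a \<Rightarrow> nat \<Rightarrow> 'a \<Rightarrow> nat" where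
  "d_minus G v0 i x = (if i = 0 then 0 else card {y \<in> layer G v0 (i - 1). (x, y) \<in> parcs G})"

definition d_plus :: "'a pair_pre_digraph \<Rightarrow> 'a \<Rightarrow> nat \<Rightarrow> 'a \<Rightarrow> nat" where
  "d_plus G v0 i x = card {y \<in> layer G v0 (i + 1). (x, y) \<in> parcs G}"

text \<open>
  \<open>ord i\<close> enumerates layer \<open>i\<close> by decreasing \<open>d_minus\<close>, with ties in any order; the first
  \<open>k\<close> vertices of the layer are \<open>set (take k (ord i))\<close>.
\<close>

definition layers_ordered :: "'a pair_pre_digraph \<Rightarrow> 'a \<Rightarrow> (nat \<Rightarrow> 'a list) \<Rightarrow> bool" where
  "layers_ordered G v0 ord \<longleftrightarrow>
     (\<forall>i \<le> last_layer G v0.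
        distinct (ord i) \<and> set (ord i) = layer G v0 i \<and>
        sorted_wrt (\<lambda>x y. d_minus G v0 i x \<ge> d_minus G v0 i y) (ord i))"

text \<open>
  The map \<open>B\<close> of a configuration is defined on the vertex set of \<open>H\<close> only; the extensional
  function space makes it a unique HOL function.
\<close>

type_synonym 'c configuration = "nat \<times> ('c \<Rightarrow> nat)"

definition special_configuration :: "'c pair_pre_digraph \<Rightarrow> nat \<Rightarrow> 'c configuration" where
  "special_configuration H i = (i, \<lambda>c \<in> pverts H. 0)"

definition configurations ::
    "'a pair_pre_digraph \<Rightarrow> 'a \<Rightarrow> 'c pair_pre_digraph \<Rightarrow> 'c configuration set" where
  "configurations G v0 H =
     {(i, B). 1 \<le> i \<and> i \<le> last_layer G v0 \<and> B \<in> pverts H \<rightarrow>\<^sub>E {0..card (layer G v0 i)} \<and>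
        0 \<in> B ` pverts H \<and> card (layer G v0 i) \<in> B ` pverts H}
     \<union> {special_configuration H 0, special_configuration H (last_layer G v0 + 1)}"

definition configuration_step ::
    "'a pair_pre_digraph \<Rightarrow> 'a \<Rightarrow> (nat \<Rightarrow> 'a list) \<Rightarrow> 'c pair_pre_digraph \<Rightarrow> ('a \<Rightarrow> 'c set) \<Rightarrow>
     'c configuration \<Rightarrow> 'c configuration \<Rightarrow> bool" where
  "configuration_step G v0 ord H P S S' \<longleftrightarrow>
     (case (S, S') of ((i, B), (i', B')) \<Rightarrow>
        i' = i + 1 \<and>
        (\<exists>\<chi>. homomorphism \<chi> (with_proj G \<restriction> layer G v0 i) (with_proj H) \<and>
             obeys \<chi> P (layer G v0 i) \<and>
             (\<forall>c \<in> pverts H. \<forall>x \<in> set (take (B c) (ord i)). \<chi> x \<noteq> c) \<and>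
             (\<forall>x \<in> layer G v0 i. \<forall>c \<in> pverts H.
                (\<chi> x, c) \<notin> parcs H \<longrightarrow> B' c \<ge> d_plus G v0 i x)))"

definition configuration_graph ::
    "'a pair_pre_digraph \<Rightarrow> 'a \<Rightarrow> (nat \<Rightarrow> 'a list) \<Rightarrow> 'c pair_pre_digraph \<Rightarrow> ('a \<Rightarrow> 'c set) \<Rightarrow>
     'c configuration pair_pre_digraph" where
  "configuration_graph G v0 ord H P =
     \<lparr> pverts = configurations G v0 H,
       parcs = {(S, S'). S \<in> configurations G v0 H \<and> S' \<in> configurations G v0 H \<and>
                  configuration_step G v0 ord H P S S'} \<rparr>"

end

theory Submission
  imports Defs
begin

text \<open>
  Nestedness of neighbourhoods in a chain graph makes the neighbours of \<open>x \<in> L\<^sub>i\<close> in \<open>L\<^sub>i\<^sub>+\<^sub>1\<close>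
  the first \<open>d\<^sub>+(x)\<close> vertices of \<open>L\<^sub>i\<^sub>+\<^sub>1\<close>. For a given map on \<open>L\<^sub>i\<close>, respecting all edges to
  \<open>L\<^sub>i\<^sub>+\<^sub>1\<close> therefore means that each colour \<open>c\<close> avoids an initial segment of \<open>L\<^sub>i\<^sub>+\<^sub>1\<close>, whose
  length is the largest \<open>d\<^sub>+(x)\<close> over the \<open>x \<in> L\<^sub>i\<close> with colour not adjacent to \<open>c\<close>. These
  lengths form a configuration: the colour of the first vertex of \<open>L\<^sub>i\<^sub>+\<^sub>1\<close> has length 0, and if
  \<open>x\<close> is adjacent to the last vertex, a non-neighbour of the (non-universal) colour of \<open>x\<close> has
  length \<open>|L\<^sub>i\<^sub>+\<^sub>1|\<close>. Conversely, the maps witnessing the steps of a path fit together, layer by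
  layer.
\<close>

section \<open>Prefixes of lists and arcs of induced subgraphs\<close>

lemma down_closed_eq_take:
  assumes "distinct ys" and "N \<subseteq> set ys" and "sorted_wrt (\<lambda>a b. b \<in> N \<longrightarrow> a \<in> N) ys"
  shows "N = set (take (card N) ys)"
  using assms
proof (induction ys arbitrary: N)
  case Nil
  then show ?case by simp
next
  case (Cons y ys)
  show ?case
  proof (cases "N = {}")
    case False
    \<comment> \<open>Some element of \<open>N\<close> is the head or comes after it; closure
      towards the front puts the head in \<open>N\<close>.\<close>
    then have y: "y \<in> N"
      using Cons.prems by auto
    have fin: "finite N"
      using Cons.prems(2) by (rule finite_subset) simp
    have "sorted_wrt (\<lambda>a b. b \<in> N - {y} \<longrightarrow> a \<in> N - {y}) ys"
      using Cons.prems(1,3) by (auto elim!: sorted_wrt_mono_rel[rotated])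
    then have IH: "N - {y} = set (take (card (N - {y})) ys)"
      using Cons.prems by (intro Cons.IH) auto
    have "N = insert y (N - {y})"
      using y by auto
    also have "\<dots> = insert y (set (take (card (N - {y})) ys))"
      by (subst IH) (rule refl)
    also have "\<dots> = set (take (card N) (y # ys))"
      using card_Suc_Diff1[OF fin y] by (metis list.simps(15) take_Suc_Cons)
    finally show ?thesis .
  qed simp
qed

lemma arcs_induce_eqI:
  assumes "\<forall>a \<in> S. \<forall>b \<in> S. (a, b) \<in> parcs B \<longleftrightarrow> (a, b) \<in> E" and "E \<subseteq> S \<times> S"
  shows "arcs (with_proj B \<restriction> S) = E"
  using assms by auto

section \<open>Distance layers of a digraph\<close>

context pair_fin_digraph
begin

lemma awalk_cost_one: "awalk_cost (\<lambda>_. 1) p = real (length p)"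
  by (induction p) auto

text \<open>With nonnegative weights the infimum \<open>\<mu>\<close> is attained by a path, and
  unit weights make its cost a length, hence a natural number.\<close>

lemma layer_exists:
  assumes "v0 \<rightarrow>\<^sup>*\<^bsub>with_proj G\<^esub> v"
  shows "\<exists>i. v \<in> layer G v0 i"
proof -
  have "\<exists>p. apath v0 p v \<and> \<mu> (\<lambda>_. 1) v0 v = awalk_cost (\<lambda>_. 1) p"
    using assms by (rule min_cost_awalk) simp
  then show ?thesis
    using reachable_in_verts[OF assms] by (auto simp: layer_def awalk_cost_one)
qed

lemma layer_unique: "v \<in> layer G v0 i \<Longrightarrow> v \<in> layer G v0 j \<Longrightarrow> i = j"
  by (simp add: layer_def)

lemma not_in_layer: "v \<in> layer G v0 i \<Longrightarrow> i \<noteq> j \<Longrightarrow> v \<notin> layer G v0 j"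
  using layer_unique by blast

text \<open>Triangle inequality for \<open>\<mu>\<close> along one arc. Without symmetry it bounds
  only forward jumps between layers.\<close>

lemma layer_arc_le:
  assumes "v \<in> layer G v0 i" and "w \<in> layer G v0 j" and "(v, w) \<in> parcs G"
  shows "j \<le> Suc i"
proof -
  have "\<mu> (\<lambda>_. 1) v0 w \<le> \<mu> (\<lambda>_. 1) v0 v + ereal 1"
    using assms(3) by (intro pos_cost_mu_triangle[where e = "(v, w)"]) (auto simp: arc_to_ends_def)
  then show ?thesis
    using assms(1,2) by (simp add: layer_def)
qed

text \<open>Take the source of the last arc of a shortest path to \<open>w\<close>: the rest of the
  path shows distance at most \<open>i\<close>, and \<open>layer_arc_le\<close> excludes a smaller
  one.\<close>

lemma layer_Suc_pred:
  assumes "w \<in> layer G v0 (Suc i)"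
  obtains v where "v \<in> layer G v0 i" and "(v, w) \<in> parcs G"
proof -
  have mu: "\<mu> (\<lambda>_. 1) v0 w = ereal (real (Suc i))"
    using assms by (simp add: layer_def)
  then have "v0 \<rightarrow>\<^sup>*\<^bsub>with_proj G\<^esub> w"
    using \<mu>_reach_conv[of "\<lambda>_. 1" v0 w] by simp
  then have "\<exists>p. apath v0 p w \<and> \<mu> (\<lambda>_. 1) v0 w = awalk_cost (\<lambda>_. 1) p"
    by (rule min_cost_awalk) simp
  then obtain p where p: "awalk v0 p w" and len: "length p = Suc i"
    using mu by (auto simp: awalk_cost_one dest!: awalkI_apath simp del: of_nat_Suc)
  then obtain q v w' where "p = q @ [(v, w')]"
    by (cases p rule: rev_cases) auto
  then have q: "awalk v0 q v" and lq: "length q = i" and e: "(v, w) \<in> parcs G"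
    using p len by (auto simp: awalk_simps)
  obtain j where j: "v \<in> layer G v0 j"
    using layer_exists reachable_awalkI[OF q] by blast
  have "j \<le> i"
    using min_cost_le_walk_cost[OF q, of "\<lambda>_. 1"] j lq by (simp add: layer_def awalk_cost_one)
  moreover have "i \<le> j"
    using layer_arc_le[OF j assms e] by simp
  ultimately show thesis
    using that j e by simp
qed

end

section \<open>Layers and neighbourhoods in a multi-chain ordering\<close>

locale ordered_multichain = pair_pseudo_graph G
  for G :: "'a pair_pre_digraph" and v0 :: 'a and ord :: "nat \<Rightarrow> 'a list" +
  assumes conn: "connected (with_proj G)"
    and multichain: "multichain_ordering_from G v0"
    and ordered: "layers_ordered G v0 ord"
begin

abbreviation "L \<equiv> layer G v0"

abbreviation "z \<equiv> last_layer G v0"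

abbreviation "dp \<equiv> d_plus G v0"

lemma arc_sym: "(x, y) \<in> parcs G \<Longrightarrow> (y, x) \<in> parcs G"
  using pair_sym_arcs by (auto simp: symmetric_def dest: symD)

lemma vert_in_layer: "x \<in> pverts G \<Longrightarrow> \<exists>i. x \<in> L i"
proof (rule layer_exists)
  assume x: "x \<in> pverts G"
  have "strongly_connected (with_proj G)"
    using pair_sym_arcs conn by (rule symmetric_connected_imp_strongly_connected)
  then show "v0 \<rightarrow>\<^sup>*\<^bsub>with_proj G\<^esub> x"
    using x multichain by (auto simp: strongly_connected_def multichain_ordering_from_def)
qed

lemma layer_subset: "L i \<subseteq> pverts G"
  by (auto simp: layer_def)

lemma finite_layer: "finite (L i)"
  using layer_subset pair_finite_verts by (rule finite_subset)

text \<open>Ensures that the \<open>GREATEST\<close> in \<open>last_layer\<close> is attained.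
  Layers are disjoint, so the index of a nonempty one is determined by any of its vertices, and
  there are finitely many vertices.\<close>

lemma layers_bounded: "\<exists>b. \<forall>i. L i \<noteq> {} \<longrightarrow> i \<le> b"
proof -
  have "{i. L i \<noteq> {}} \<subseteq> (\<lambda>x. THE i. x \<in> L i) ` pverts G"
  proof
    fix i assume "i \<in> {i. L i \<noteq> {}}"
    then obtain x where "x \<in> L i"
      by auto
    moreover from this have "(THE i. x \<in> L i) = i"
      by (blast intro: layer_unique)
    ultimately show "i \<in> (\<lambda>x. THE i. x \<in> L i) ` pverts G"
      using layer_subset by force
  qed
  then have "finite {i. L i \<noteq> {}}"
    using pair_finite_verts by (meson finite_imageI finite_subset)
  then show ?thesis
    by (auto simp: finite_nat_set_iff_bounded_le)
qed

lemma layer_le_last: "x \<in> L i \<Longrightarrow> i \<le> z"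
  unfolding last_layer_def using layers_bounded by (auto intro: Greatest_le_nat)

text \<open>Downward induction from \<open>z\<close>: by \<open>layer_Suc_pred\<close> a nonempty
  layer has a nonempty predecessor.\<close>

lemma layer_nonempty: "i \<le> z \<Longrightarrow> L i \<noteq> {}"
proof (induction rule: inc_induct)
  case base
  have "v0 \<in> pverts G"
    using multichain by (simp add: multichain_ordering_from_def)
  then have "\<exists>i. L i \<noteq> {}"
    using vert_in_layer by blast
  then show ?case
    unfolding last_layer_def using layers_bounded by (metis (mono_tags, lifting) GreatestI_ex_nat)
next
  case (step i)
  then show ?case
    using layer_Suc_pred by (metis ex_in_conv)
qed

lemma dp_last: "dp z x = 0"
proof -
  have "L (Suc z) = {}"
    using layer_le_last by fastforce
  then show ?thesis
    by (simp add: d_plus_def)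
qed

lemma dp_le: "dp i x \<le> card (L (Suc i))"
  using finite_layer by (auto simp: d_plus_def intro: card_mono)

lemma ord_props:
  assumes "i \<le> z"
  shows "distinct (ord i)" and "set (ord i) = L i" and "length (ord i) = card (L i)"
proof -
  show 1: "distinct (ord i)" and 2: "set (ord i) = L i"
    using ordered assms by (auto simp: layers_ordered_def)
  show "length (ord i) = card (L i)"
    using distinct_card[OF 1] 2 by simp
qed

text \<open>
  Otherwise \<open>le\<close> provides \<open>x'\<close> adjacent to \<open>y'\<close> but not to \<open>y\<close>, and \<open>x, y, x', y'\<close> induce
  a \<open>2K\<^sub>2\<close>.
\<close>

lemma neighbours_closed:
  assumes i: "i < z" and x: "x \<in> L i" and y: "y \<in> L (Suc i)" and y': "y' \<in> L (Suc i)"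
    and le: "d_minus G v0 (Suc i) y \<le> d_minus G v0 (Suc i) y'" and xy: "(x, y) \<in> parcs G"
  shows "(x, y') \<in> parcs G"
proof (rule ccontr)
  assume xy': "(x, y') \<notin> parcs G"
  let ?N = "\<lambda>y. {u \<in> L i. (y, u) \<in> parcs G}"
  have "\<not> ?N y' \<subseteq> ?N y"
  proof
    assume "?N y' \<subseteq> ?N y"
    moreover have "x \<in> ?N y" "x \<notin> ?N y'"
      using x xy xy' arc_sym by auto
    ultimately have "?N y' \<subset> ?N y"
      by blast
    then have "card (?N y') < card (?N y)"
      using finite_layer by (intro psubset_card_mono) auto
    then show False
      using le by (simp add: d_minus_def)
  qed
  then obtain x' where x': "x' \<in> L i" "(x', y') \<in> parcs G" "(x', y) \<notin> parcs G"
    using arc_sym by blast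
  have notin: "x \<notin> L (Suc i)" "x' \<notin> L (Suc i)" "y \<notin> L i" "y' \<notin> L i"
    using x x'(1) y y' not_in_layer by (metis n_not_Suc_n)+
  have sym: "(y, x) \<in> parcs G" "(y', x) \<notin> parcs G" "(y', x') \<in> parcs G" "(y, x') \<notin> parcs G"
    using xy xy' x' by (auto dest: arc_sym)
  have neq: "x \<noteq> y" "x \<noteq> y'" "x' \<noteq> y" "x' \<noteq> y'" "x \<noteq> x'" "y \<noteq> y'"
    using notin x x'(1,2) xy xy' by metis+
  let ?S = "{x, y, x', y'}"
  let ?E = "{(x, y), (y, x), (x', y'), (y', x')}"
  let ?B = "between_layers G v0 i"
  have "\<forall>a \<in> ?S. \<forall>b \<in> ?S. (a, b) \<in> parcs ?B \<longleftrightarrow> (a, b) \<in> ?E"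
    by (simp add: between_layers_def x y x' y' xy xy' notin sym neq neq[symmetric])
  then have "arcs (with_proj ?B \<restriction> ?S) = ?E"
    by (rule arcs_induce_eqI) simp
  moreover have "distinct [x, y, x', y']"
    using neq by simp
  moreover have "?S \<subseteq> pverts ?B"
    by (simp add: between_layers_def x y x' y')
  ultimately have "has_induced_2K2 (between_layers G v0 i)"
    unfolding has_induced_2K2_def by blast
  then show False
    using multichain i by (auto simp: multichain_ordering_from_def chain_graph_def)
qed

text \<open>Earlier vertices of \<open>ord (Suc i)\<close> have at least as large
  \<open>d_minus\<close>, so by \<open>neighbours_closed\<close> adjacency to \<open>x\<close>
  passes to them.\<close>

lemma neighbours_initial:
  assumes i: "i < z" and x: "x \<in> L i"
  shows "{y \<in> L (Suc i). (x, y) \<in> parcs G} = set (take (dp i x) (ord (Suc i)))"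
proof -
  let ?N = "{y \<in> L (Suc i). (x, y) \<in> parcs G}"
  note ps = ord_props[of "Suc i"]
  have "sorted_wrt (\<lambda>a b. d_minus G v0 (Suc i) a \<ge> d_minus G v0 (Suc i) b) (ord (Suc i))"
    using ordered i by (auto simp: layers_ordered_def)
  then have "sorted_wrt (\<lambda>a b. b \<in> ?N \<longrightarrow> a \<in> ?N) (ord (Suc i))"
    by (rule sorted_wrt_mono_rel[rotated]) (use i x ps neighbours_closed in auto)
  then have "?N = set (take (card ?N) (ord (Suc i)))"
    using i ps by (intro down_closed_eq_take) auto
  then show ?thesis
    by (simp add: d_plus_def)
qed

text \<open>Any \<open>x\<close> in layer \<open>i\<close> adjacent to the last vertex of the next
  layer works, since its neighbours there form an initial segment.\<close>

lemma ex_dp_full: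
  assumes "i < z"
  obtains x where "x \<in> L i" and "dp i x = card (L (Suc i))"
proof -
  note ps = ord_props[of "Suc i"]
  have ne: "ord (Suc i) \<noteq> []"
    using layer_nonempty[of "Suc i"] ps assms by auto
  let ?n = "length (ord (Suc i))"
  let ?y = "ord (Suc i) ! (?n - 1)"
  have "?y \<in> L (Suc i)"
    using ne ps assms by (metis Suc_leI diff_less length_greater_0_conv nth_mem zero_less_one)
  moreover from this obtain x where x: "x \<in> L i" "(x, ?y) \<in> parcs G"
    by (rule layer_Suc_pred)
  ultimately have "?y \<in> set (take (dp i x) (ord (Suc i)))"
    using neighbours_initial[OF assms x(1)] by auto
  then obtain k where "k < dp i x" "k < ?n" "ord (Suc i) ! k = ?y"
    by (auto simp: in_set_conv_nth)
  \<comment> \<open>By distinctness the last vertex occurs at no other position, so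
    \<open>dp i x\<close> exceeds \<open>?n - 1\<close>.\<close>
  moreover from this have "k = ?n - 1"
    using ps(1) assms ne by (auto simp: nth_eq_iff_index_eq)
  ultimately have "card (L (Suc i)) \<le> dp i x"
    using ps(3) assms by auto
  then show thesis
    using that x(1) dp_le[of i x] by simp
qed

end

section \<open>From a homomorphism to a path of configurations\<close>

locale list_homomorphism_instance = ordered_multichain G v0 ord
  for G :: "'a pair_pre_digraph" and v0 :: 'a and ord :: "nat \<Rightarrow> 'a list" +
  fixes H :: "'c pair_pre_digraph" and P :: "'a \<Rightarrow> 'c set"
  assumes H: "pair_pseudo_graph H"
begin

abbreviation "conf_graph \<equiv> with_proj (configuration_graph G v0 ord H P)"

lemma wf_conf_graph: "wf_digraph conf_graph"
  by (auto simp: wf_digraph_wp_iff configuration_graph_def pair_wf_digraph_def)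

text \<open>The lower bounds that condition (3) of a step imposes on the value at \<open>c\<close>
  in layer \<open>i\<close>. The form \<open>Suc j = i\<close> makes the set empty for
  \<open>i = 0\<close>.\<close>

definition forced :: "('a \<Rightarrow> 'c) \<Rightarrow> nat \<Rightarrow> 'c \<Rightarrow> nat set" where
  "forced \<chi> i c = {dp j x |j x. Suc j = i \<and> x \<in> L j \<and> (\<chi> x, c) \<notin> parcs H}"

text \<open>The least map meeting condition (3). Inserting 0 gives \<open>Max\<close> a value when
  nothing is forced.\<close>

definition hom_conf :: "('a \<Rightarrow> 'c) \<Rightarrow> nat \<Rightarrow> 'c \<Rightarrow> nat" where
  "hom_conf \<chi> i = (\<lambda>c \<in> pverts H. Max (insert 0 (forced \<chi> i c)))"

lemma finite_forced: "finite (forced \<chi> i c)"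
proof -
  have "forced \<chi> i c \<subseteq> dp (i - 1) ` L (i - 1)"
    by (auto simp: forced_def)
  then show ?thesis
    by (rule finite_surj[OF finite_layer])
qed

lemma hom_conf_ge:
  assumes "x \<in> L i" and "c \<in> pverts H" and "(\<chi> x, c) \<notin> parcs H"
  shows "dp i x \<le> hom_conf \<chi> (Suc i) c"
proof -
  have "dp i x \<in> insert 0 (forced \<chi> (Suc i) c)"
    using assms by (auto simp: forced_def)
  then have "dp i x \<le> Max (insert 0 (forced \<chi> (Suc i) c))"
    by (intro Max_ge) (simp_all add: finite_forced)
  then show ?thesis
    using assms(2) by (simp only: hom_conf_def restrict_apply if_True)
qed

lemma hom_conf_cases:
  assumes "c \<in> pverts H"
  obtains "hom_conf \<chi> i c = 0"
  | j x where "i = Suc j" "x \<in> L j" "(\<chi> x, c) \<notin> parcs H" "hom_conf \<chi> i c = dp j x"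
proof -
  have "Max (insert 0 (forced \<chi> i c)) \<in> insert 0 (forced \<chi> i c)"
    by (intro Max_in) (simp_all add: finite_forced)
  then have "hom_conf \<chi> i c \<in> insert 0 (forced \<chi> i c)"
    using assms by (simp only: hom_conf_def restrict_apply if_True)
  then show thesis
    using that by (auto simp: forced_def)
qed

lemma hom_conf_zero: "hom_conf \<chi> 0 = (\<lambda>c \<in> pverts H. 0)"
  by (simp add: hom_conf_def forced_def)

text \<open>Every bound forced from layer \<open>z\<close> is 0 by \<open>dp_last\<close>, so the
  path ends in the special configuration.\<close>

lemma hom_conf_last: "hom_conf \<chi> (Suc z) = (\<lambda>c \<in> pverts H. 0)"
proof
  fix c
  show "hom_conf \<chi> (Suc z) c = (\<lambda>c \<in> pverts H. 0) c"
  proof (cases "c \<in> pverts H")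
    case True
    then show ?thesis
      by (cases rule: hom_conf_cases[of c \<chi> "Suc z"]) (auto simp: dp_last True)
  qed (simp add: hom_conf_def)
qed

context
  fixes \<chi>
  assumes hom: "homomorphism \<chi> (with_proj G) (with_proj H)"
    and nonuniversal: "\<nexists>c. universal_vertex H c"
begin

text \<open>A positive value is attained as \<open>dp j x\<close> for some \<open>x\<close> in the
  previous layer. The first \<open>dp j x\<close> vertices are neighbours of \<open>x\<close>, so
  none has a colour not adjacent to that of \<open>x\<close>.\<close>

lemma hom_conf_avoids:
  assumes i: "i \<le> z" and c: "c \<in> pverts H" and y: "y \<in> set (take (hom_conf \<chi> i c) (ord i))"
  shows "\<chi> y \<noteq> c"
  using c
proof (cases rule: hom_conf_cases[of c \<chi> i])
  case 1
  then show ?thesis using y by simp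
next
  case (2 j x)
  then have "(x, y) \<in> parcs G"
    using neighbours_initial[of j x] i y by auto
  then show ?thesis
    using hom 2 by (auto simp: homomorphism_def)
qed

lemma hom_conf_configuration:
  assumes "i \<le> Suc z"
  shows "(i, hom_conf \<chi> i) \<in> configurations G v0 H"
proof -
  consider "i = 0" | "i = Suc z" | j where "i = Suc j" "j < z"
    using assms by (metis le_Suc_eq less_Suc_eq_le not0_implies_Suc not_less_eq_eq Suc_le_eq)
  then show ?thesis
  proof cases
    case (3 j)
    note ps = ord_props[of i]
    have "i \<le> z"
      using 3 by simp
    have inH: "\<chi> x \<in> pverts H" if "x \<in> L k" for x k
      using hom that layer_subset by (auto simp: homomorphism_def)
    have le: "hom_conf \<chi> i c \<le> card (L i)" if "c \<in> pverts H" for c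
      using that by (cases rule: hom_conf_cases[of c \<chi> i]) (auto simp: dp_le)
    obtain y ys where yys: "ord i = y # ys"
      using layer_nonempty[OF \<open>i \<le> z\<close>] ps(2)[OF \<open>i \<le> z\<close>] by (cases "ord i") auto
    then have y: "\<chi> y \<in> pverts H"
      using ps(2)[OF \<open>i \<le> z\<close>] inH[of y i] by auto
    \<comment> \<open>A positive value would place the first vertex \<open>y\<close> among those
      that avoid its own colour.\<close>
    have "hom_conf \<chi> i (\<chi> y) = 0"
      using hom_conf_avoids[OF \<open>i \<le> z\<close> y, of y] yys by (cases "hom_conf \<chi> i (\<chi> y)") auto
    then have zero: "0 \<in> hom_conf \<chi> i ` pverts H"
      using y by force
    obtain x where x: "x \<in> L j" "dp j x = card (L i)"
      using ex_dp_full[OF 3(2)] 3(1) by blast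
    \<comment> \<open>The colour of \<open>x\<close> is not universal; as \<open>x\<close> sees all
      of layer \<open>i\<close>, this \<open>c\<close> is barred from the whole layer.\<close>
    obtain c where c: "c \<in> pverts H" "(\<chi> x, c) \<notin> parcs H"
      using nonuniversal inH[OF x(1)] by (auto simp: universal_vertex_def)
    have "hom_conf \<chi> i c = card (L i)"
      using hom_conf_ge[of x j c \<chi>] le[OF c(1)] x c 3(1) by simp
    then have "card (L i) \<in> hom_conf \<chi> i ` pverts H"
      using c by force
    then show ?thesis
      using zero le 3 by (auto simp: configurations_def hom_conf_def intro!: restrict_PiE_iff[THEN iffD2])
  qed (auto simp: configurations_def special_configuration_def hom_conf_zero hom_conf_last)
qed

lemma hom_conf_step:
  assumes "i \<le> z" and "obeys \<chi> P (pverts G)"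
  shows "configuration_step G v0 ord H P (i, hom_conf \<chi> i) (Suc i, hom_conf \<chi> (Suc i))"
proof -
  have "homomorphism \<chi> (with_proj G \<restriction> L i) (with_proj H)"
    using hom layer_subset by (auto simp: homomorphism_def arcs_ends_conv)
  moreover have "obeys \<chi> P (L i)"
    using assms(2) layer_subset by (auto simp: obeys_def)
  moreover have "\<forall>c \<in> pverts H. \<forall>x \<in> set (take (hom_conf \<chi> i c) (ord i)). \<chi> x \<noteq> c"
    using hom_conf_avoids[OF assms(1)] by blast
  moreover have "\<forall>x \<in> L i. \<forall>c \<in> pverts H. (\<chi> x, c) \<notin> parcs H \<longrightarrow> hom_conf \<chi> (Suc i) c \<ge> dp i x"
    using hom_conf_ge by blast
  ultimately show ?thesis
    unfolding configuration_step_def prod.case by (metis Suc_eq_plus1)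
qed

lemma path_if_homomorphism:
  assumes "obeys \<chi> P (pverts G)"
  shows "\<exists>p. pre_digraph.apath conf_graph
    (special_configuration H 0) p (special_configuration H (z + 1))"
proof -
  interpret C: wf_digraph conf_graph
    by (rule wf_conf_graph)
  have "(0, hom_conf \<chi> 0) \<rightarrow>\<^sup>*\<^bsub>conf_graph\<^esub> (i, hom_conf \<chi> i)" if "i \<le> Suc z" for i
    using that
  proof (induction i)
    case 0
    then show ?case
      using hom_conf_configuration[of 0] C.reachable_refl by (simp add: configuration_graph_def)
  next
    case (Suc i)
    have "((i, hom_conf \<chi> i), (Suc i, hom_conf \<chi> (Suc i))) \<in> arcs_ends conf_graph"
      using Suc.prems hom_conf_configuration[of i] hom_conf_configuration[of "Suc i"]
        hom_conf_step[of i] assms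
      by (auto simp: configuration_graph_def)
    then show ?case
      using Suc C.reachable_adj_trans by fastforce
  qed
  from this[of "Suc z"] show ?thesis
    by (simp add: C.reachable_apath special_configuration_def hom_conf_zero hom_conf_last)
qed

end

section \<open>From a path of configurations to a homomorphism\<close>

definition partial_hom :: "('a \<Rightarrow> 'c) \<Rightarrow> nat \<Rightarrow> bool" where
  "partial_hom \<chi> i \<longleftrightarrow>
     (\<forall>j<i. \<forall>x \<in> L j. \<chi> x \<in> pverts H \<and> \<chi> x \<in> P x) \<and>
     (\<forall>j<i. \<forall>k<i. \<forall>x \<in> L j. \<forall>y \<in> L k. (x, y) \<in> parcs G \<longrightarrow> (\<chi> x, \<chi> y) \<in> parcs H)"

text \<open>What condition (3) of the step into \<open>S\<close> hands on to the next step. For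
  index 0 it holds vacuously, which starts the induction.\<close>

definition bounded_by :: "('a \<Rightarrow> 'c) \<Rightarrow> 'c configuration \<Rightarrow> bool" where
  "bounded_by \<chi> S \<longleftrightarrow>
     (\<forall>j x c. Suc j = fst S \<and> x \<in> L j \<and> c \<in> pverts H \<and> (\<chi> x, c) \<notin> parcs H \<longrightarrow> dp j x \<le> snd S c)"

text \<open>The map \<open>\<psi>\<close> of the step colours layer \<open>i\<close>. Only edges to
  layer \<open>i - 1\<close> link it to the earlier layers; they are respected because condition (3)
  of the previous step and condition (2) of this one meet in \<open>B\<close>.\<close>

lemma partial_hom_step:
  assumes hom: "partial_hom \<chi> i" and bnd: "bounded_by \<chi> (i, B)" and i: "i \<le> z"
    and step: "configuration_step G v0 ord H P (i, B) S'"
  obtains \<chi>' where "partial_hom \<chi>' (Suc i)" and "bounded_by \<chi>' S'"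
proof -
  interpret H: pair_pseudo_graph H
    by (rule H)
  obtain B' where S': "S' = (Suc i, B')"
    using step by (cases S') (auto simp: configuration_step_def)
  obtain \<psi> where \<psi>: "homomorphism \<psi> (with_proj G \<restriction> L i) (with_proj H)" "obeys \<psi> P (L i)"
    and avoid: "\<And>c x. c \<in> pverts H \<Longrightarrow> x \<in> set (take (B c) (ord i)) \<Longrightarrow> \<psi> x \<noteq> c"
    and ge: "\<And>c x. x \<in> L i \<Longrightarrow> c \<in> pverts H \<Longrightarrow> (\<psi> x, c) \<notin> parcs H \<Longrightarrow> dp i x \<le> B' c"
    using step S' by (auto simp: configuration_step_def)
  have \<psi>_H: "\<psi> x \<in> pverts H" if "x \<in> L i" for x
    using \<psi>(1) that by (auto simp: homomorphism_def)
  have \<psi>_arc: "(\<psi> x, \<psi> y) \<in> parcs H" if "x \<in> L i" "y \<in> L i" "(x, y) \<in> parcs G" for x y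
    using \<psi>(1) that by (force simp: homomorphism_def arcs_ends_conv)
  have H_sym: "(d, c) \<in> parcs H" if "(c, d) \<in> parcs H" for c d
    using H.pair_sym_arcs that by (auto simp: symmetric_def dest: symD)
  define \<chi>' where "\<chi>' x = (if x \<in> L i then \<psi> x else \<chi> x)" for x
  have new: "\<chi>' x = \<psi> x" if "x \<in> L i" for x
    using that by (simp add: \<chi>'_def)
  have old: "\<chi>' x = \<chi> x" if "x \<in> L j" "j < i" for x j
    using not_in_layer[OF that(1), of i] that(2) by (simp add: \<chi>'_def)
  \<comment> \<open>Otherwise \<open>y\<close>, a neighbour of \<open>x\<close>, is among the first
    \<open>dp j x\<close> vertices of layer \<open>i\<close>, hence among the first
    \<open>B (\<psi> y)\<close>, which \<open>\<psi>\<close> keeps free of the colour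
    \<open>\<psi> y\<close>.\<close>
  have cross: "(\<chi> x, \<psi> y) \<in> parcs H"
    if j: "j < i" and x: "x \<in> L j" and y: "y \<in> L i" and xy: "(x, y) \<in> parcs G" for j x y
  proof (rule ccontr)
    assume non: "(\<chi> x, \<psi> y) \<notin> parcs H"
    have Suc: "Suc j = i"
      using layer_arc_le[OF x y xy] j by simp
    then have "dp j x \<le> B (\<psi> y)"
      using bnd x \<psi>_H[OF y] non by (auto simp: bounded_by_def)
    moreover have "y \<in> set (take (dp j x) (ord i))"
      using neighbours_initial[of j x] x y xy Suc i by auto
    ultimately have "y \<in> set (take (B (\<psi> y)) (ord i))"
      by (meson set_take_subset_set_take subsetD)
    then show False
      using avoid[OF \<psi>_H[OF y]] by blast
  qed
  have "(\<chi>' x, \<chi>' y) \<in> parcs H"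
    if "j < Suc i" "k < Suc i" "x \<in> L j" "y \<in> L k" "(x, y) \<in> parcs G" for j k x y
  proof -
    consider "j < i" "k < i" | "j < i" "k = i" | "j = i" "k < i" | "j = i" "k = i"
      using \<open>j < Suc i\<close> \<open>k < Suc i\<close> by linarith
    then show ?thesis
    proof cases
      case 1
      then show ?thesis using \<open>x \<in> L j\<close> \<open>y \<in> L k\<close> \<open>(x, y) \<in> parcs G\<close> hom old
        by (auto simp: partial_hom_def)
    next
      case 2
      then show ?thesis using \<open>x \<in> L j\<close> \<open>y \<in> L k\<close> \<open>(x, y) \<in> parcs G\<close> cross old new
        by auto
    next
      \<comment> \<open>Symmetry of \<open>G\<close> and of \<open>H\<close> turns this into
        \<open>cross\<close> for the reversed arc.\<close>
      case 3
      then show ?thesis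
        using \<open>x \<in> L j\<close> \<open>y \<in> L k\<close> arc_sym[OF \<open>(x, y) \<in> parcs G\<close>] cross[of k y x] old new H_sym
        by auto
    next
      case 4
      then show ?thesis using \<open>x \<in> L j\<close> \<open>y \<in> L k\<close> \<open>(x, y) \<in> parcs G\<close> \<psi>_arc new
        by auto
    qed
  qed
  moreover have "\<chi>' x \<in> pverts H \<and> \<chi>' x \<in> P x" if "j < Suc i" "x \<in> L j" for j x
    using that hom old new \<psi>_H \<psi>(2) by (cases "j = i") (auto simp: partial_hom_def obeys_def less_Suc_eq)
  ultimately have "partial_hom \<chi>' (Suc i)"
    by (simp add: partial_hom_def)
  moreover have "bounded_by \<chi>' S'"
    using ge new S' by (auto simp: bounded_by_def)
  ultimately show thesis
    by (rule that)
qed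

lemma homomorphism_if_path:
  assumes "pre_digraph.apath conf_graph
    (special_configuration H 0) p (special_configuration H (z + 1))"
  shows "\<exists>\<chi>. homomorphism \<chi> (with_proj G) (with_proj H) \<and> obeys \<chi> P (pverts G)"
proof -
  interpret C: wf_digraph conf_graph
    by (rule wf_conf_graph)
  have "special_configuration H 0 \<rightarrow>\<^sup>*\<^bsub>conf_graph\<^esub> special_configuration H (z + 1)"
    using assms C.reachable_apath by blast
  then have "\<exists>\<chi>. partial_hom \<chi> (fst (special_configuration H (z + 1))) \<and>
      bounded_by \<chi> (special_configuration H (z + 1))"
  \<comment> \<open>The map stays existential, since each step replaces it by an extension to one
    more layer.\<close>
  proof (induction rule: C.reachable_induct)
    case base
    then show ?case
      by (simp add: special_configuration_def partial_hom_def bounded_by_def)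
  next
    case (step S S')
    obtain i B where S: "S = (i, B)"
      by (cases S)
    have confs: "S' \<in> configurations G v0 H" and st: "configuration_step G v0 ord H P (i, B) S'"
      using step.hyps S by (auto simp: configuration_graph_def)
    then have S': "fst S' = Suc i"
      by (cases S') (simp add: configuration_step_def)
    \<comment> \<open>No configuration has index beyond \<open>Suc z\<close>, so the step leaves a
      layer \<open>i \<le> z\<close>, as \<open>partial_hom_step\<close> requires.\<close>
    moreover have "fst S' \<le> Suc z"
      using confs by (auto simp: configurations_def special_configuration_def)
    ultimately show ?case
      using step.IH S partial_hom_step[OF _ _ _ st] by auto
  qed
  then obtain \<chi> where \<chi>: "partial_hom \<chi> (Suc z)"
    by (auto simp: special_configuration_def)
  \<comment> \<open>The layers below \<open>Suc z\<close> cover all vertices, so the partial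
    homomorphism is total.\<close>
  have vert: "\<exists>j < Suc z. x \<in> L j" if "x \<in> pverts G" for x
    using vert_in_layer[OF that] layer_le_last by (auto simp: less_Suc_eq_le)
  have "(\<chi> x, \<chi> y) \<in> parcs H" if "(x, y) \<in> parcs G" for x y
    using \<chi> vert[OF in_arcsD1[OF that]] vert[OF in_arcsD2[OF that]] that
    unfolding partial_hom_def by blast
  moreover have "\<chi> x \<in> pverts H \<and> \<chi> x \<in> P x" if "x \<in> pverts G" for x
    using \<chi> vert[OF that] unfolding partial_hom_def by blast
  ultimately show ?thesis
    by (intro exI[of _ \<chi>]) (simp add: homomorphism_def obeys_def)
qed

end

theorem theorem3:
  fixes G :: "'a pair_pre_digraph" and H :: "'c pair_pre_digraph"
    and v0 :: 'a and ord :: "nat \<Rightarrow> 'a list" and P :: "'a \<Rightarrow> 'c set"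
  assumes "pair_pseudo_graph G" and "connected (with_proj G)"
    and "pair_pseudo_graph H"
    and "multichain_ordering_from G v0" and "layers_ordered G v0 ord"
    and "\<forall>x \<in> pverts G. P x \<subseteq> pverts H"
    and "\<not> (\<exists>c. universal_vertex H c)"
  shows "(\<exists>\<chi>. homomorphism \<chi> (with_proj G) (with_proj H) \<and> obeys \<chi> P (pverts G)) \<longleftrightarrow>
    (\<exists>p. pre_digraph.apath (with_proj (configuration_graph G v0 ord H P))
           (special_configuration H 0) p (special_configuration H (last_layer G v0 + 1)))"
proof -
  interpret list_homomorphism_instance G v0 ord H P
    using assms by (intro list_homomorphism_instance.intro ordered_multichain.intro
      ordered_multichain_axioms.intro list_homomorphism_instance_axioms.intro)
  show ?thesis
    using path_if_homomorphism[OF _ assms(7)] homomorphism_if_path by metis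
qed

end
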